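(* Let $k\ge1$, let $\Lambda$ be a row-finite and cofinal $k$-graph with no sources, and suppose that $\ell\colon\Lambda^0\to\mathbb{Z}$ satisfies $\ell(s(\lambda))=1+\ell(r(\lambda))$ for all $i\in\{1,\dots,k\}$ and all $\lambda\in\Lambda^{e_i}$. Suppose that for each $w\in\Lambda^0$ and each pair of distinct indices $i,j\in\{1,\dots,k\}$ there are strictly positive rational numbers $n_{w,i,j}$, $m_{w,i,j}$ such that $$|w\Lambda^{e_i}v|=n_{w,i,j}\,|w\Lambda^{e_j}v|\ \text{ for all }v\in\Lambda^0\quad\text{and}\quad|u\Lambda^{e_i}w|=m_{w,i,j}\,|u\Lambda^{e_j}w|\ \text{ for all }u\in\Lambda^0.$$ Suppose that there exist $w,i,j$ such that $n_{w,i,j}\neq1$. Then $S(\Lambda)$ is purely infinite.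
   Context: $\mathbb{N}=\{0,1,2,\dots\}$, and $e_1,\dots,e_k$ are the standard generators of $\mathbb{N}^k$. A $k$-graph is a nonempty countable small category $\Lambda$ with a functor $d\colon\Lambda\to\mathbb{N}^k$ such that whenever $d(\lambda)=m+n$ there are unique $\mu,\nu\in\Lambda$ with $d(\mu)=m$, $d(\nu)=n$, $\lambda=\mu\nu$. $\Lambda^n=d^{-1}(n)$; $\Lambda^0$ is the set of vertices (identity morphisms); $r(\lambda),s(\lambda)\in\Lambda^0$ are the codomain and domain of $\lambda$. For $v,w\in\Lambda^0$: $v\Lambda=\{\lambda:r(\lambda)=v\}$, $v\Lambda^n=v\Lambda\cap\Lambda^n$, $v\Lambda^nw=\{\lambda\in v\Lambda^n:s(\lambda)=w\}$. $\Lambda$ is row-finite if every $v\Lambda^n$ is finite, has no sources if every $v\Lambda^n$ is nonempty, and is cofinal if for all $v,w\in\Lambda^0$ there is $n\in\mathbb{N}^k$ with $s(w\Lambda^n)\subseteq s(v\Lambda)$. The semigroup $S(\Lambda)$: let $\mathbb{N}\Lambda^0$ be the finitely supported functions $\Lambda^0\to\mathbb{N}$ with generators $\delta_v$, and for $n\in\mathbb{N}^k$ let $A_n^t\colon\mathbb{N}\Lambda^0\to\mathbb{N}\Lambda^0$ be the additive map $A_n^t\delta_v=\sum_{\lambda\in v\Lambda^n}\delta_{s(\lambda)}$. Write $x\sim_\Lambda y$ if $A_p^tx=A_q^ty$ for some $p,q\in\mathbb{N}^k$. Write $f\approx_\Lambda g$ if there are finitely many $x_i,y_i\in\mathbb{N}\Lambda^0$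 with $f\sim_\Lambda\sum_ix_i$, $g\sim_\Lambda\sum_iy_i$ and $x_i\sim_\Lambda y_i$ for all $i$. Then $\approx_\Lambda$ is an equivalence relation and $S(\Lambda)=\mathbb{N}\Lambda^0/\!\approx_\Lambda$ is an abelian semigroup with identity under $[f]_\Lambda+[g]_\Lambda=[f+g]_\Lambda$, with the algebraic preorder ($a\le b$ iff $a+c=b$ for some $c$). It is purely infinite if $2x\le x$ for every $x\in S(\Lambda)$. *)

theory Defs
  imports "HOL-Analysis.Finite_Cartesian_Product" "HOL-Algebra.Group"
    "HOL-Library.Multiset" "HOL-Library.Countable_Set"
begin

section \<open>\<open>k\<close>-graphs\<close>

text \<open>
  Small categories are given by their morphisms only: an object is identified with its identity
  morphism, so \<open>rng\<close> (codomain) and \<open>src\<close> (domain) take identity morphisms as values.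
  \<open>cmp \<Lambda> \<mu> \<nu>\<close> is \<open>\<mu>\<nu>\<close> and is meaningful only when \<open>src \<Lambda> \<mu> = rng \<Lambda> \<nu>\<close>.
  The index set of the \<open>k\<close> coordinates is the finite (nonempty) type \<open>'k\<close>, so \<open>k = CARD('k) \<ge> 1\<close>.
\<close>

record ('a, 'k) graph_data =
  mor :: "'a set"
  rng :: "'a \<Rightarrow> 'a"
  src :: "'a \<Rightarrow> 'a"
  cmp :: "'a \<Rightarrow> 'a \<Rightarrow> 'a"
  deg :: "'a \<Rightarrow> nat ^ 'k"

locale small_category =
  fixes \<Lambda> :: "('a, 'k::finite) graph_data"
  assumes rng_mor: "\<And>x. x \<in> mor \<Lambda> \<Longrightarrow> rng \<Lambda> x \<in> mor \<Lambda>"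
    and src_mor: "\<And>x. x \<in> mor \<Lambda> \<Longrightarrow> src \<Lambda> x \<in> mor \<Lambda>"
    and rng_rng: "\<And>x. x \<in> mor \<Lambda> \<Longrightarrow> rng \<Lambda> (rng \<Lambda> x) = rng \<Lambda> x"
    and src_rng: "\<And>x. x \<in> mor \<Lambda> \<Longrightarrow> src \<Lambda> (rng \<Lambda> x) = rng \<Lambda> x"
    and rng_src: "\<And>x. x \<in> mor \<Lambda> \<Longrightarrow> rng \<Lambda> (src \<Lambda> x) = src \<Lambda> x"
    and src_src: "\<And>x. x \<in> mor \<Lambda> \<Longrightarrow> src \<Lambda> (src \<Lambda> x) = src \<Lambda> x"
    and cmp_mor: "\<And>x y. \<lbrakk>x \<in> mor \<Lambda>; y \<in> mor \<Lambda>; src \<Lambda> x = rng \<Lambda> y\<rbrakk> \<Longrightarrow> cmp \<Lambda> x y \<in> mor \<Lambda>"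
    and rng_cmp: "\<And>x y. \<lbrakk>x \<in> mor \<Lambda>; y \<in> mor \<Lambda>; src \<Lambda> x = rng \<Lambda> y\<rbrakk> \<Longrightarrow> rng \<Lambda> (cmp \<Lambda> x y) = rng \<Lambda> x"
    and src_cmp: "\<And>x y. \<lbrakk>x \<in> mor \<Lambda>; y \<in> mor \<Lambda>; src \<Lambda> x = rng \<Lambda> y\<rbrakk> \<Longrightarrow> src \<Lambda> (cmp \<Lambda> x y) = src \<Lambda> y"
    and cmp_assoc: "\<And>x y z. \<lbrakk>x \<in> mor \<Lambda>; y \<in> mor \<Lambda>; z \<in> mor \<Lambda>; src \<Lambda> x = rng \<Lambda> y; src \<Lambda> y = rng \<Lambda> z\<rbrakk>
          \<Longrightarrow> cmp \<Lambda> (cmp \<Lambda> x y) z = cmp \<Lambda> x (cmp \<Lambda> y z)"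
    and cmp_rng: "\<And>x. x \<in> mor \<Lambda> \<Longrightarrow> cmp \<Lambda> (rng \<Lambda> x) x = x"
    and cmp_src: "\<And>x. x \<in> mor \<Lambda> \<Longrightarrow> cmp \<Lambda> x (src \<Lambda> x) = x"

locale k_graph = small_category \<Lambda> for \<Lambda> :: "('a, 'k::finite) graph_data" +
  assumes mor_nonempty: "mor \<Lambda> \<noteq> {}"
    and mor_countable: "countable (mor \<Lambda>)"
    and deg_identity: "\<And>x. \<lbrakk>x \<in> mor \<Lambda>; src \<Lambda> x = x\<rbrakk> \<Longrightarrow> deg \<Lambda> x = 0"
    and deg_cmp: "\<And>x y. \<lbrakk>x \<in> mor \<Lambda>; y \<in> mor \<Lambda>; src \<Lambda> x = rng \<Lambda> y\<rbrakk>
          \<Longrightarrow> deg \<Lambda> (cmp \<Lambda> x y) = deg \<Lambda> x + deg \<Lambda> y"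
    and unique_factorization: "\<And>x m n. \<lbrakk>x \<in> mor \<Lambda>; deg \<Lambda> x = m + n\<rbrakk>
          \<Longrightarrow> \<exists>!(\<mu>, \<nu>). \<mu> \<in> mor \<Lambda> \<and> \<nu> \<in> mor \<Lambda> \<and> src \<Lambda> \<mu> = rng \<Lambda> \<nu>
                \<and> deg \<Lambda> \<mu> = m \<and> deg \<Lambda> \<nu> = n \<and> x = cmp \<Lambda> \<mu> \<nu>"

text \<open>\<open>\<Lambda>\<^sup>n\<close>, \<open>\<Lambda>\<^sup>0\<close>, \<open>v\<Lambda>\<close>, \<open>v\<Lambda>\<^sup>n\<close>, \<open>v\<Lambda>\<^sup>nw\<close> and the generators \<open>e\<^sub>i\<close>, in this order.\<close>

definition paths :: "('a, 'k::finite) graph_data \<Rightarrow> nat ^ 'k \<Rightarrow> 'a set" where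
  "paths \<Lambda> n = {x \<in> mor \<Lambda>. deg \<Lambda> x = n}"

definition vertices :: "('a, 'k::finite) graph_data \<Rightarrow> 'a set" where
  "vertices \<Lambda> = paths \<Lambda> 0"

definition mor_at :: "('a, 'k::finite) graph_data \<Rightarrow> 'a \<Rightarrow> 'a set" where
  "mor_at \<Lambda> v = {x \<in> mor \<Lambda>. rng \<Lambda> x = v}"

definition paths_at :: "('a, 'k::finite) graph_data \<Rightarrow> 'a \<Rightarrow> nat ^ 'k \<Rightarrow> 'a set" where
  "paths_at \<Lambda> v n = mor_at \<Lambda> v \<inter> paths \<Lambda> n"

definition paths_between :: "('a, 'k::finite) graph_data \<Rightarrow> 'a \<Rightarrow> nat ^ 'k \<Rightarrow> 'a \<Rightarrow> 'a set" where
  "paths_between \<Lambda> v n w = {x \<in> paths_at \<Lambda> v n. src \<Lambda> x = w}"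

definition gen :: "'k::finite \<Rightarrow> nat ^ 'k" where
  "gen i = axis i 1"

definition row_finite :: "('a, 'k::finite) graph_data \<Rightarrow> bool" where
  "row_finite \<Lambda> \<longleftrightarrow> (\<forall>v\<in>vertices \<Lambda>. \<forall>n. finite (paths_at \<Lambda> v n))"

definition no_sources :: "('a, 'k::finite) graph_data \<Rightarrow> bool" where
  "no_sources \<Lambda> \<longleftrightarrow> (\<forall>v\<in>vertices \<Lambda>. \<forall>n. paths_at \<Lambda> v n \<noteq> {})"

definition cofinal_graph :: "('a, 'k::finite) graph_data \<Rightarrow> bool" where
  "cofinal_graph \<Lambda> \<longleftrightarrow> (\<forall>v\<in>vertices \<Lambda>. \<forall>w\<in>vertices \<Lambda>. \<exists>n.
      src \<Lambda> ` paths_at \<Lambda> w n \<subseteq> src \<Lambda> ` mor_at \<Lambda> v)"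

lemma (in k_graph) factorization_unique:
  assumes "\<mu> \<in> mor \<Lambda>" "\<nu> \<in> mor \<Lambda>" "src \<Lambda> \<mu> = rng \<Lambda> \<nu>"
    and "\<mu>' \<in> mor \<Lambda>" "\<nu>' \<in> mor \<Lambda>" "src \<Lambda> \<mu>' = rng \<Lambda> \<nu>'"
    and "deg \<Lambda> \<mu> = deg \<Lambda> \<mu>'" "deg \<Lambda> \<nu> = deg \<Lambda> \<nu>'" "cmp \<Lambda> \<mu> \<nu> = cmp \<Lambda> \<mu>' \<nu>'"
  shows "\<mu> = \<mu>' \<and> \<nu> = \<nu>'"
proof -
  obtain p where p: "\<And>q. (case q of (a, b) \<Rightarrow> a \<in> mor \<Lambda> \<and> b \<in> mor \<Lambda> \<and> src \<Lambda> a = rng \<Lambda> b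
      \<and> deg \<Lambda> a = deg \<Lambda> \<mu> \<and> deg \<Lambda> b = deg \<Lambda> \<nu> \<and> cmp \<Lambda> \<mu> \<nu> = cmp \<Lambda> a b) \<Longrightarrow> q = p"
    using unique_factorization[OF cmp_mor[OF assms(1-3)] deg_cmp[OF assms(1-3)]] by (elim ex1E) blast
  have "(\<mu>, \<nu>) = p" by (rule p) (simp add: assms(1-3))
  moreover have "(\<mu>', \<nu>') = p" by (rule p) (simp add: assms)
  ultimately show ?thesis by blast
qed

lemma (in k_graph) vertices_eq_identities: "vertices \<Lambda> = {x \<in> mor \<Lambda>. src \<Lambda> x = x}"
proof -
  have "src \<Lambda> x = x" if x: "x \<in> mor \<Lambda>" "deg \<Lambda> x = 0" for x
  proof -
    have "deg \<Lambda> (src \<Lambda> x) = 0" "deg \<Lambda> (rng \<Lambda> x) = 0"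
      using x by (auto intro!: deg_identity simp: src_mor rng_mor src_src src_rng)
    then show ?thesis
      using factorization_unique[of "rng \<Lambda> x" x x "src \<Lambda> x"] x
      by (simp add: src_mor rng_mor src_rng rng_src cmp_rng cmp_src)
  qed
  then show ?thesis
    by (auto simp: vertices_def paths_def deg_identity)
qed


section \<open>The semigroup \<open>S(\<Lambda>)\<close>\<close>

text \<open>
  Finitely supported functions \<open>\<Lambda>\<^sup>0 \<rightarrow> \<nat>\<close> are multisets of vertices: \<open>\<delta>\<^sub>v\<close> is \<open>{#v#}\<close> and
  the value of \<open>x\<close> at \<open>v\<close> is \<open>count x v\<close>.
\<close>

definition NV :: "('a, 'k::finite) graph_data \<Rightarrow> 'a multiset set" where
  "NV \<Lambda> = {x. set_mset x \<subseteq> vertices \<Lambda>}"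

text \<open>The map \<open>A\<^sub>n\<^sup>t\<close>; the inner sum is only meaningful for row-finite \<open>\<Lambda>\<close>.\<close>

definition At :: "('a, 'k::finite) graph_data \<Rightarrow> nat ^ 'k \<Rightarrow> 'a multiset \<Rightarrow> 'a multiset" where
  "At \<Lambda> n x = (\<Sum>v\<in>#x. \<Sum>\<mu>\<in>paths_at \<Lambda> v n. {#src \<Lambda> \<mu>#})"

definition sim :: "('a, 'k::finite) graph_data \<Rightarrow> 'a multiset \<Rightarrow> 'a multiset \<Rightarrow> bool" where
  "sim \<Lambda> x y \<longleftrightarrow> (\<exists>p q. At \<Lambda> p x = At \<Lambda> q y)"

definition approx_rel :: "('a, 'k::finite) graph_data \<Rightarrow> ('a multiset \<times> 'a multiset) set" where
  "approx_rel \<Lambda> = {(f, g). f \<in> NV \<Lambda> \<and> g \<in> NV \<Lambda> \<and>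
     (\<exists>(N::nat) x y. (\<forall>i<N. x i \<in> NV \<Lambda> \<and> y i \<in> NV \<Lambda> \<and> sim \<Lambda> (x i) (y i))
        \<and> sim \<Lambda> f (\<Sum>i<N. x i) \<and> sim \<Lambda> g (\<Sum>i<N. y i))}"

text \<open>
  The operation is written additively in the literature; here it is the \<open>mult\<close> of a \<open>monoid\<close>
  record, with identity the class of \<open>0\<close>.
\<close>

definition S :: "('a, 'k::finite) graph_data \<Rightarrow> 'a multiset set monoid" where
  "S \<Lambda> = \<lparr>carrier = NV \<Lambda> // approx_rel \<Lambda>,
          monoid.mult = (\<lambda>a b. \<Union>f\<in>a. \<Union>g\<in>b. approx_rel \<Lambda> `` {f + g}),
          one = approx_rel \<Lambda> `` {{#}}\<rparr>"

definition alg_le :: "('b, 'c) monoid_scheme \<Rightarrow> 'b \<Rightarrow> 'b \<Rightarrow> bool" where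
  "alg_le M a b \<longleftrightarrow> (\<exists>c\<in>carrier M. a \<otimes>\<^bsub>M\<^esub> c = b)"

definition purely_infinite :: "('b, 'c) monoid_scheme \<Rightarrow> bool" where
  "purely_infinite M \<longleftrightarrow> (\<forall>x\<in>carrier M. alg_le M (x \<otimes>\<^bsub>M\<^esub> x) x)"


subsection \<open>Well-definedness\<close>

lemma At_empty [simp]: "At \<Lambda> n {#} = {#}"
  and At_add: "At \<Lambda> n (x + y) = At \<Lambda> n x + At \<Lambda> n y"
  and At_single: "At \<Lambda> n {#v#} = (\<Sum>\<mu>\<in>paths_at \<Lambda> v n. {#src \<Lambda> \<mu>#})"
  by (simp_all add: At_def)

lemma At_sum: "At \<Lambda> n (\<Sum>i\<in>I. x i) = (\<Sum>i\<in>I. At \<Lambda> n (x i))"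
  by (induction I rule: infinite_finite_induct) (simp_all add: At_add)

lemma NV_empty [simp]: "{#} \<in> NV \<Lambda>"
  and NV_add [simp]: "x + y \<in> NV \<Lambda> \<longleftrightarrow> x \<in> NV \<Lambda> \<and> y \<in> NV \<Lambda>"
  and NV_single [simp]: "{#v#} \<in> NV \<Lambda> \<longleftrightarrow> v \<in> vertices \<Lambda>"
  and NV_add_mset [simp]: "add_mset v x \<in> NV \<Lambda> \<longleftrightarrow> v \<in> vertices \<Lambda> \<and> x \<in> NV \<Lambda>"
  by (auto simp: NV_def)

lemma NV_sum: "finite I \<Longrightarrow> (\<Sum>i\<in>I. x i) \<in> NV \<Lambda> \<longleftrightarrow> (\<forall>i\<in>I. x i \<in> NV \<Lambda>)"
  by (induction I rule: finite_induct) auto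

lemma sim_refl: "sim \<Lambda> x x" and sim_sym: "sim \<Lambda> x y \<Longrightarrow> sim \<Lambda> y x"
  unfolding sim_def by metis+

locale row_finite_k_graph = k_graph \<Lambda> for \<Lambda> :: "('a, 'k::finite) graph_data" +
  assumes row_finite: "row_finite \<Lambda>"
begin

lemma finite_paths_at: "v \<in> vertices \<Lambda> \<Longrightarrow> finite (paths_at \<Lambda> v n)"
  using row_finite by (auto simp: row_finite_def)

lemma src_vertices: "x \<in> mor \<Lambda> \<Longrightarrow> src \<Lambda> x \<in> vertices \<Lambda>"
  by (simp add: vertices_eq_identities src_mor src_src)

lemma At_NV: "x \<in> NV \<Lambda> \<Longrightarrow> At \<Lambda> n x \<in> NV \<Lambda>"
proof (induction x)
  case (add v x)
  then have "At \<Lambda> n {#v#} \<in> NV \<Lambda>"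
    by (simp add: At_single NV_sum finite_paths_at) (simp add: src_vertices paths_at_def mor_at_def)
  then show ?case
    using add At_add[of \<Lambda> n "{#v#}" x] by simp
qed simp

lemma paths_at_add_bij:
  assumes "v \<in> vertices \<Lambda>"
  shows "bij_betw (\<lambda>(\<mu>, \<nu>). cmp \<Lambda> \<mu> \<nu>)
    (SIGMA \<mu>:paths_at \<Lambda> v n. paths_at \<Lambda> (src \<Lambda> \<mu>) m) (paths_at \<Lambda> v (n + m))"
  (is "bij_betw ?c ?A ?B")
proof (rule bij_betwI')
  fix a b assume a: "a \<in> ?A" and b: "b \<in> ?A"
  obtain \<mu> \<nu> \<mu>' \<nu>' where ab: "a = (\<mu>, \<nu>)" "b = (\<mu>', \<nu>')" by fastforce
  show "?c a = ?c b \<longleftrightarrow> a = b"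
    using a b factorization_unique[of \<mu> \<nu> \<mu>' \<nu>'] unfolding ab
    by (auto simp: paths_at_def mor_at_def paths_def)
next
  fix a assume "a \<in> ?A"
  then show "?c a \<in> ?B"
    by (auto simp: paths_at_def mor_at_def paths_def cmp_mor deg_cmp rng_cmp)
next
  fix x assume "x \<in> ?B"
  then have x: "x \<in> mor \<Lambda>" "deg \<Lambda> x = n + m" "rng \<Lambda> x = v"
    by (auto simp: paths_at_def mor_at_def paths_def)
  from unique_factorization[OF x(1,2)] obtain \<mu> \<nu> where
    "\<mu> \<in> mor \<Lambda>" "\<nu> \<in> mor \<Lambda>" "src \<Lambda> \<mu> = rng \<Lambda> \<nu>" "deg \<Lambda> \<mu> = n" "deg \<Lambda> \<nu> = m" "x = cmp \<Lambda> \<mu> \<nu>"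
    by auto
  then show "\<exists>a\<in>?A. x = ?c a"
    using x(3) by (intro bexI[of _ "(\<mu>, \<nu>)"]) (auto simp: paths_at_def mor_at_def paths_def rng_cmp)
qed

lemma At_At: "x \<in> NV \<Lambda> \<Longrightarrow> At \<Lambda> m (At \<Lambda> n x) = At \<Lambda> (n + m) x"
proof (induction x)
  case (add v x)
  have v: "v \<in> vertices \<Lambda>" using add by simp
  have fin: "finite (paths_at \<Lambda> (src \<Lambda> \<mu>) m)" if "\<mu> \<in> paths_at \<Lambda> v n" for \<mu>
    using that by (intro finite_paths_at src_vertices) (simp add: paths_at_def mor_at_def)
  have "At \<Lambda> m (At \<Lambda> n {#v#}) = (\<Sum>\<mu>\<in>paths_at \<Lambda> v n. \<Sum>\<nu>\<in>paths_at \<Lambda> (src \<Lambda> \<mu>) m. {#src \<Lambda> \<nu>#})"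
    by (simp add: At_single At_sum)
  also have "\<dots> = (\<Sum>(\<mu>, \<nu>)\<in>(SIGMA \<mu>:paths_at \<Lambda> v n. paths_at \<Lambda> (src \<Lambda> \<mu>) m). {#src \<Lambda> \<nu>#})"
    using fin v by (subst sum.Sigma) (auto simp: finite_paths_at)
  also have "\<dots> = (\<Sum>(\<mu>, \<nu>)\<in>(SIGMA \<mu>:paths_at \<Lambda> v n. paths_at \<Lambda> (src \<Lambda> \<mu>) m). {#src \<Lambda> (cmp \<Lambda> \<mu> \<nu>)#})"
    by (intro sum.cong refl) (auto simp: paths_at_def mor_at_def src_cmp)
  also have "\<dots> = (\<Sum>x\<in>paths_at \<Lambda> v (n + m). {#src \<Lambda> x#})"
    using sum.reindex_bij_betw[OF paths_at_add_bij[OF v, of n m], of "\<lambda>x. {#src \<Lambda> x#}"]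
    by (simp add: case_prod_unfold)
  finally have "At \<Lambda> m (At \<Lambda> n {#v#}) = At \<Lambda> (n + m) {#v#}"
    by (simp add: At_single)
  moreover have "At \<Lambda> m (At \<Lambda> n x) = At \<Lambda> (n + m) x"
    using add by simp
  ultimately have "At \<Lambda> m (At \<Lambda> n ({#v#} + x)) = At \<Lambda> (n + m) ({#v#} + x)"
    by (simp only: At_add)
  then show ?case by simp
qed simp

lemma sim_At: "x \<in> NV \<Lambda> \<Longrightarrow> sim \<Lambda> (At \<Lambda> n x) x"
  unfolding sim_def by (metis At_At)

lemma sim_trans:
  assumes "x \<in> NV \<Lambda>" "y \<in> NV \<Lambda>" "z \<in> NV \<Lambda>" "sim \<Lambda> x y" "sim \<Lambda> y z"
  shows "sim \<Lambda> x z"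
proof -
  obtain p q p' q' where "At \<Lambda> p x = At \<Lambda> q y" "At \<Lambda> p' y = At \<Lambda> q' z"
    using assms by (auto simp: sim_def)
  then have "At \<Lambda> (p + p') x = At \<Lambda> (q' + q) z"
    using assms(1-3) by (metis At_At add.commute)
  then show ?thesis by (auto simp: sim_def)
qed

lemma sim_At_left:
  assumes "x \<in> NV \<Lambda>" "y \<in> NV \<Lambda>" "sim \<Lambda> x y"
  shows "sim \<Lambda> x (At \<Lambda> n y)"
  by (rule sim_trans[OF assms(1,2) At_NV assms(3) sim_sym[OF sim_At]]) (rule assms)+

lemma sim_At_At:
  assumes "x \<in> NV \<Lambda>" "y \<in> NV \<Lambda>" "sim \<Lambda> x y"
  shows "sim \<Lambda> (At \<Lambda> m x) (At \<Lambda> n y)"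
  by (rule sim_At_left[OF At_NV[OF assms(1)] assms(2)])
     (rule sim_sym[OF sim_At_left[OF assms(2,1) sim_sym[OF assms(3)]]])

lemma approx_relI:
  assumes fg: "f \<in> NV \<Lambda>" "g \<in> NV \<Lambda>" and I: "finite I"
    and xy: "\<And>i. i \<in> I \<Longrightarrow> x i \<in> NV \<Lambda> \<and> y i \<in> NV \<Lambda> \<and> sim \<Lambda> (x i) (y i)"
    and "sim \<Lambda> f (\<Sum>i\<in>I. x i)" "sim \<Lambda> g (\<Sum>i\<in>I. y i)"
  shows "(f, g) \<in> approx_rel \<Lambda>"
proof -
  obtain h where h: "bij_betw h {..<card I} I"
    using ex_bij_betw_nat_finite[OF I] by (auto simp: atLeast0LessThan)
  have "(\<Sum>i\<in>I. u i) = (\<Sum>i<card I. u (h i))" for u :: "_ \<Rightarrow> 'a multiset"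
    using sum.reindex_bij_betw[OF h, of u] by simp
  moreover have "h i \<in> I" if "i < card I" for i
    using h that by (auto simp: bij_betw_def)
  ultimately have "\<exists>(N::nat) x y. (\<forall>i<N. x i \<in> NV \<Lambda> \<and> y i \<in> NV \<Lambda> \<and> sim \<Lambda> (x i) (y i))
        \<and> sim \<Lambda> f (\<Sum>i<N. x i) \<and> sim \<Lambda> g (\<Sum>i<N. y i)"
    using assms by (intro exI[of _ "card I"] exI[of _ "\<lambda>i. x (h i)"] exI[of _ "\<lambda>i. y (h i)"]) simp
  then show ?thesis
    using fg by (simp add: approx_rel_def)
qed

text \<open>The relation \<open>\<sim>\<close> to the sums can be replaced by equality after applying one \<open>A\<^sub>p\<^sup>t\<close> to each side.\<close>

lemma approx_relD:
  assumes "(f, g) \<in> approx_rel \<Lambda>"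
  shows "\<exists>p q (N::nat) x y. f \<in> NV \<Lambda> \<and> g \<in> NV \<Lambda>
    \<and> (\<forall>i<N. x i \<in> NV \<Lambda> \<and> y i \<in> NV \<Lambda> \<and> sim \<Lambda> (x i) (y i))
    \<and> At \<Lambda> p f = (\<Sum>i<N. x i) \<and> At \<Lambda> q g = (\<Sum>i<N. y i)"
proof -
  have fg: "f \<in> NV \<Lambda>" "g \<in> NV \<Lambda>" and "\<exists>(N::nat) x y.
      (\<forall>i<N. x i \<in> NV \<Lambda> \<and> y i \<in> NV \<Lambda> \<and> sim \<Lambda> (x i) (y i))
      \<and> sim \<Lambda> f (\<Sum>i<N. x i) \<and> sim \<Lambda> g (\<Sum>i<N. y i)"
    using assms by (simp_all only: approx_rel_def mem_Collect_eq prod.case)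
  then obtain N :: nat and x y where xy: "\<forall>i<N. x i \<in> NV \<Lambda> \<and> y i \<in> NV \<Lambda> \<and> sim \<Lambda> (x i) (y i)"
    and f: "sim \<Lambda> f (\<Sum>i<N. x i)" and g: "sim \<Lambda> g (\<Sum>i<N. y i)"
    by (elim exE conjE)
  obtain p p' where p: "At \<Lambda> p f = At \<Lambda> p' (\<Sum>i<N. x i)"
    using f unfolding sim_def by (elim exE)
  obtain q q' where q: "At \<Lambda> q g = At \<Lambda> q' (\<Sum>i<N. y i)"
    using g unfolding sim_def by (elim exE)
  have "sim \<Lambda> (At \<Lambda> p' (x i)) (At \<Lambda> q' (y i))" if "i < N" for i
    using xy that by (simp add: sim_At_At)
  then show ?thesis
    by (intro exI[of _ p] exI[of _ q] exI[of _ N] exI[of _ "\<lambda>i. At \<Lambda> p' (x i)"]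
          exI[of _ "\<lambda>i. At \<Lambda> q' (y i)"])
       (simp add: fg xy p q At_sum At_NV)
qed

lemma At_shift: "x \<in> NV \<Lambda> \<Longrightarrow> At \<Lambda> p x = y \<Longrightarrow> At \<Lambda> (p + n) x = At \<Lambda> n y"
  using At_At by force

end

lemma mset_split:
  fixes b :: "'i \<Rightarrow> 'a multiset"
  assumes "finite J" "a \<subseteq># (\<Sum>j\<in>J. b j)"
  shows "\<exists>z. (\<forall>j\<in>J. z j \<subseteq># b j) \<and> a = (\<Sum>j\<in>J. z j)"
  using assms
proof (induction J arbitrary: a rule: finite_induct)
  case (insert k J)
  have "a - b k \<subseteq># (\<Sum>j\<in>J. b j)"
    using insert by (simp add: subset_eq_diff_conv add.commute)
  then obtain z where z: "\<forall>j\<in>J. z j \<subseteq># b j" "a - b k = (\<Sum>j\<in>J. z j)"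
    using insert.IH by blast
  have "(\<Sum>j\<in>J. (z(k := a \<inter># b k)) j) = (\<Sum>j\<in>J. z j)"
    using insert by (intro sum.cong) auto
  moreover have "a = (a \<inter># b k) + (a - b k)"
    by (rule multiset_eqI) (simp add: min_def)
  ultimately show ?case
    using z insert.hyps by (intro exI[of _ "z(k := a \<inter># b k)"]) auto
qed simp

lemma mset_refinement:
  fixes a :: "'i \<Rightarrow> 'a multiset" and b :: "'j \<Rightarrow> 'a multiset"
  assumes "finite I" "finite J" "(\<Sum>i\<in>I. a i) = (\<Sum>j\<in>J. b j)"
  shows "\<exists>z. (\<forall>i\<in>I. a i = (\<Sum>j\<in>J. z i j)) \<and> (\<forall>j\<in>J. b j = (\<Sum>i\<in>I. z i j))"
  using assms(1,3)
proof (induction I arbitrary: b rule: finite_induct)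
  case empty
  have "b j = {#}" if "j \<in> J" for j
    using sum.remove[OF assms(2) that, of b] empty by simp
  then show ?case by simp
next
  case (insert k I)
  have "a k \<subseteq># (\<Sum>j\<in>J. b j)" using insert by (metis mset_subset_eq_add_left sum.insert)
  then obtain w where w: "\<forall>j\<in>J. w j \<subseteq># b j" "a k = (\<Sum>j\<in>J. w j)"
    using mset_split assms(2) by blast
  have "(\<Sum>j\<in>J. b j) = (\<Sum>j\<in>J. (b j - w j) + w j)"
    using w by (intro sum.cong) auto
  also have "\<dots> = (\<Sum>j\<in>J. b j - w j) + a k"
    by (simp only: sum.distrib w(2))
  finally have "(\<Sum>i\<in>I. a i) = (\<Sum>j\<in>J. b j - w j)"
    using insert by (simp add: add.commute)
  then obtain z where z: "\<forall>i\<in>I. a i = (\<Sum>j\<in>J. z i j)" "\<forall>j\<in>J. b j - w j = (\<Sum>i\<in>I. z i j)"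
    using insert.IH[of "\<lambda>j. b j - w j"] by blast
  have *: "(\<Sum>i\<in>I. (z(k := w)) i j) = (\<Sum>i\<in>I. z i j)" for j
    using insert by (intro sum.cong) auto
  have "b j = w j + (\<Sum>i\<in>I. z i j)" if "j \<in> J" for j
    using z(2) w(1) that by (metis subset_mset.add_diff_inverse)
  then show ?case
    using z w insert.hyps * by (intro exI[of _ "z(k := w)"]) auto
qed

context row_finite_k_graph
begin

text \<open>Finitely many relations \<open>u\<^sub>i \<sim> t\<^sub>i\<close> can be realised with one common index on the left.\<close>

lemma sim_uniform:
  assumes "\<And>i. i < (N::nat) \<Longrightarrow> u i \<in> NV \<Lambda> \<and> t i \<in> NV \<Lambda> \<and> sim \<Lambda> (u i) (t i)"
  shows "\<exists>P c. \<forall>i<N. At \<Lambda> P (u i) = At \<Lambda> (c i) (t i)"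
  using assms
proof (induction N)
  case (Suc N)
  then obtain P c where P: "\<forall>i<N. At \<Lambda> P (u i) = At \<Lambda> (c i) (t i)"
    using Suc.IH Suc.prems less_SucI by blast
  have "sim \<Lambda> (u N) (t N)"
    using Suc.prems by blast
  then obtain p q where pq: "At \<Lambda> p (u N) = At \<Lambda> q (t N)"
    unfolding sim_def by blast
  have "At \<Lambda> (P + p) (u i) = At \<Lambda> ((\<lambda>i. if i = N then q + P else c i + p) i) (t i)" if "i < Suc N" for i
  proof (cases "i = N")
    case True
    then show ?thesis using pq Suc.prems[OF that] by (simp add: add.commute[of P] flip: At_At)
  next
    case False
    then show ?thesis using P that Suc.prems[OF that] by (simp flip: At_At)
  qed
  then show ?case
    by (intro exI[of _ "P + p"] exI[of _ "\<lambda>i. if i = N then q + P else c i + p"]) blast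
qed simp

lemma sim_split:
  assumes "\<And>i. i < (N::nat) \<Longrightarrow> u i \<in> NV \<Lambda>" "finite J"
    and "\<And>i j. i < N \<Longrightarrow> j \<in> J \<Longrightarrow> z i j \<in> NV \<Lambda>"
    and "\<And>i. i < N \<Longrightarrow> sim \<Lambda> (u i) (\<Sum>j\<in>J. z i j)"
  shows "\<exists>c. sim \<Lambda> (\<Sum>i<N. u i) (\<Sum>(i, j)\<in>{..<N} \<times> J. At \<Lambda> (c i) (z i j))"
proof -
  obtain P c where P: "\<forall>i<N. At \<Lambda> P (u i) = At \<Lambda> (c i) (\<Sum>j\<in>J. z i j)"
    using sim_uniform[of N u "\<lambda>i. \<Sum>j\<in>J. z i j"] assms by (auto simp: NV_sum)
  then have "At \<Lambda> P (\<Sum>i<N. u i) = (\<Sum>(i, j)\<in>{..<N} \<times> J. At \<Lambda> (c i) (z i j))"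
    using assms(2) by (simp add: At_sum flip: sum.cartesian_product)
  then have "sim \<Lambda> (\<Sum>i<N. u i) (\<Sum>(i, j)\<in>{..<N} \<times> J. At \<Lambda> (c i) (z i j))"
    using sim_At[of "\<Sum>i<N. u i" P] assms(1) by (metis NV_sum finite_lessThan lessThan_iff sim_sym)
  then show ?thesis by (rule exI[of _ c])
qed

lemma approx_rel_trans:
  assumes "(f, g) \<in> approx_rel \<Lambda>" "(g, h) \<in> approx_rel \<Lambda>"
  shows "(f, h) \<in> approx_rel \<Lambda>"
proof -
  obtain p q N x y where 1: "f \<in> NV \<Lambda>" "g \<in> NV \<Lambda>"
    "\<And>i. i < (N::nat) \<Longrightarrow> x i \<in> NV \<Lambda> \<and> y i \<in> NV \<Lambda> \<and> sim \<Lambda> (x i) (y i)"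
    "At \<Lambda> p f = (\<Sum>i<N. x i)" "At \<Lambda> q g = (\<Sum>i<N. y i)"
    using approx_relD[OF assms(1)] by blast
  obtain p' q' N' x' y' where 2: "g \<in> NV \<Lambda>" "h \<in> NV \<Lambda>"
    "\<And>i. i < (N'::nat) \<Longrightarrow> x' i \<in> NV \<Lambda> \<and> y' i \<in> NV \<Lambda> \<and> sim \<Lambda> (x' i) (y' i)"
    "At \<Lambda> p' g = (\<Sum>i<N'. x' i)" "At \<Lambda> q' h = (\<Sum>i<N'. y' i)"
    using approx_relD[OF assms(2)] by blast
  have "(\<Sum>i<N. At \<Lambda> p' (y i)) = At \<Lambda> (q + p') g"
    using 1 At_shift[of g q _ p'] by (simp add: At_sum)
  also have "\<dots> = (\<Sum>i<N'. At \<Lambda> q (x' i))"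
    using 1 2 At_shift[of g p' _ q] by (simp add: At_sum add.commute)
  finally have "\<exists>z. (\<forall>i\<in>{..<N}. At \<Lambda> p' (y i) = (\<Sum>j<N'. z i j))
      \<and> (\<forall>j\<in>{..<N'}. At \<Lambda> q (x' j) = (\<Sum>i<N. z i j))"
    by (intro mset_refinement) simp_all
  then obtain z where z: "\<And>i. i < N \<Longrightarrow> At \<Lambda> p' (y i) = (\<Sum>j<N'. z i j)"
    "\<And>j. j < N' \<Longrightarrow> At \<Lambda> q (x' j) = (\<Sum>i<N. z i j)"
    unfolding Ball_def lessThan_iff by blast
  have zN: "z i j \<in> NV \<Lambda>" if "i < N" "j < N'" for i j
    using At_NV[of "y i" p'] 1(3)[of i] z(1)[of i] that by (simp add: NV_sum)
  have "sim \<Lambda> (x i) (\<Sum>j<N'. z i j)" if "i < N" for i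
    using 1(3)[OF that] sim_At_left by (simp flip: z(1)[OF that])
  then have "\<exists>c. sim \<Lambda> (\<Sum>i<N. x i) (\<Sum>(i, j)\<in>{..<N} \<times> {..<N'}. At \<Lambda> (c i) (z i j))"
    using 1(3) zN by (intro sim_split) simp_all
  then obtain c where c: "sim \<Lambda> (\<Sum>i<N. x i) (\<Sum>(i, j)\<in>{..<N} \<times> {..<N'}. At \<Lambda> (c i) (z i j))"
    by (rule exE)
  have "sim \<Lambda> (y' j) (\<Sum>i<N. z i j)" if "j < N'" for j
    using 2(3)[OF that] sim_At_left[OF _ _ sim_sym] by (simp flip: z(2)[OF that])
  then have "\<exists>c. sim \<Lambda> (\<Sum>j<N'. y' j) (\<Sum>(j, i)\<in>{..<N'} \<times> {..<N}. At \<Lambda> (c j) (z i j))"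
    using 2(3) zN by (intro sim_split) simp_all
  then obtain c' where c': "sim \<Lambda> (\<Sum>j<N'. y' j) (\<Sum>(j, i)\<in>{..<N'} \<times> {..<N}. At \<Lambda> (c' j) (z i j))"
    by (rule exE)
  have "(\<Sum>(j, i)\<in>{..<N'} \<times> {..<N}. At \<Lambda> (c' j) (z i j))
      = (\<Sum>(i, j)\<in>{..<N} \<times> {..<N'}. At \<Lambda> (c' j) (z i j))"
    unfolding sum.cartesian_product[symmetric] by (rule sum.swap)
  note c' = c'[unfolded this]
  let ?I = "{..<N} \<times> {..<N'}"
  have N1: "(\<Sum>(i, j)\<in>?I. At \<Lambda> (c i) (z i j)) \<in> NV \<Lambda>" "(\<Sum>(i, j)\<in>?I. At \<Lambda> (c' j) (z i j)) \<in> NV \<Lambda>"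
    using zN by (simp_all add: NV_sum At_NV split_beta)
  have N2: "(\<Sum>i<N. x i) \<in> NV \<Lambda>" "(\<Sum>i<N'. y' i) \<in> NV \<Lambda>"
    using 1(3) 2(3) by (simp_all add: NV_sum)
  show ?thesis
  proof (rule approx_relI[where I = ?I and x = "\<lambda>(i, j). At \<Lambda> (c i) (z i j)"
        and y = "\<lambda>(i, j). At \<Lambda> (c' j) (z i j)"])
    show "sim \<Lambda> f (\<Sum>i\<in>?I. case i of (i, j) \<Rightarrow> At \<Lambda> (c i) (z i j))"
      using sim_trans[OF 1(1) N2(1) N1(1) _ c] sim_At[OF 1(1), of p] 1(4) by (simp add: sim_sym)
    show "sim \<Lambda> h (\<Sum>i\<in>?I. case i of (i, j) \<Rightarrow> At \<Lambda> (c' j) (z i j))"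
      using sim_trans[OF 2(2) N2(2) N1(2) _ c'] sim_At[OF 2(2), of q'] 2(5) by (simp add: sim_sym)
    fix a assume "a \<in> ?I"
    then obtain i j where a: "a = (i, j)" and z': "z i j \<in> NV \<Lambda>" using zN by auto
    have "sim \<Lambda> (At \<Lambda> (c i) (z i j)) (At \<Lambda> (c' j) (z i j))"
      by (rule sim_At_At[OF z' z' sim_refl])
    then show "(case a of (i, j) \<Rightarrow> At \<Lambda> (c i) (z i j)) \<in> NV \<Lambda>
       \<and> (case a of (i, j) \<Rightarrow> At \<Lambda> (c' j) (z i j)) \<in> NV \<Lambda>
       \<and> sim \<Lambda> (case a of (i, j) \<Rightarrow> At \<Lambda> (c i) (z i j)) (case a of (i, j) \<Rightarrow> At \<Lambda> (c' j) (z i j))"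
      using z' by (simp add: a At_NV)
  next
    show "f \<in> NV \<Lambda>" by (rule 1(1))
    show "h \<in> NV \<Lambda>" by (rule 2(2))
    show "finite ?I" by simp
  qed
qed

lemma equiv_approx_rel: "equiv (NV \<Lambda>) (approx_rel \<Lambda>)"
proof (rule equivI)
  show "approx_rel \<Lambda> \<subseteq> NV \<Lambda> \<times> NV \<Lambda>"
    unfolding approx_rel_def by blast
  show "refl_on (NV \<Lambda>) (approx_rel \<Lambda>)"
  proof (rule refl_onI)
    fix f assume "f \<in> NV \<Lambda>"
    then show "(f, f) \<in> approx_rel \<Lambda>"
      by (intro approx_relI[where I = "{()}" and x = "\<lambda>_. f" and y = "\<lambda>_. f"]) (simp_all add: sim_refl)
  qed
  show "sym (approx_rel \<Lambda>)"
  proof (rule symI)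
    fix f g assume "(f, g) \<in> approx_rel \<Lambda>"
    then have fg: "f \<in> NV \<Lambda>" "g \<in> NV \<Lambda>" and "\<exists>(N::nat) x y.
        (\<forall>i<N. x i \<in> NV \<Lambda> \<and> y i \<in> NV \<Lambda> \<and> sim \<Lambda> (x i) (y i))
        \<and> sim \<Lambda> f (\<Sum>i<N. x i) \<and> sim \<Lambda> g (\<Sum>i<N. y i)"
      by (simp_all only: approx_rel_def mem_Collect_eq prod.case)
    then obtain N :: nat and x y where *: "\<forall>i<N. x i \<in> NV \<Lambda> \<and> y i \<in> NV \<Lambda> \<and> sim \<Lambda> (x i) (y i)"
      "sim \<Lambda> f (\<Sum>i<N. x i)" "sim \<Lambda> g (\<Sum>i<N. y i)"
      by (elim exE conjE)
    show "(g, f) \<in> approx_rel \<Lambda>"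
      by (rule approx_relI[where I = "{..<N}" and x = y and y = x]) (use fg * in \<open>simp_all add: sim_sym\<close>)
  qed
  show "trans (approx_rel \<Lambda>)"
    by (rule transI) (rule approx_rel_trans)
qed

lemma approx_rel_add:
  assumes "(f, f') \<in> approx_rel \<Lambda>" "(g, g') \<in> approx_rel \<Lambda>"
  shows "(f + g, f' + g') \<in> approx_rel \<Lambda>"
proof -
  obtain p q N x y where 1: "f \<in> NV \<Lambda>" "f' \<in> NV \<Lambda>"
    "\<And>i. i < (N::nat) \<Longrightarrow> x i \<in> NV \<Lambda> \<and> y i \<in> NV \<Lambda> \<and> sim \<Lambda> (x i) (y i)"
    "At \<Lambda> p f = (\<Sum>i<N. x i)" "At \<Lambda> q f' = (\<Sum>i<N. y i)"
    using approx_relD[OF assms(1)] by blast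
  obtain p' q' N' x' y' where 2: "g \<in> NV \<Lambda>" "g' \<in> NV \<Lambda>"
    "\<And>i. i < (N'::nat) \<Longrightarrow> x' i \<in> NV \<Lambda> \<and> y' i \<in> NV \<Lambda> \<and> sim \<Lambda> (x' i) (y' i)"
    "At \<Lambda> p' g = (\<Sum>i<N'. x' i)" "At \<Lambda> q' g' = (\<Sum>i<N'. y' i)"
    using approx_relD[OF assms(2)] by blast
  let ?I = "{..<N} <+> {..<N'}"
  let ?x = "case_sum (\<lambda>i. At \<Lambda> p' (x i)) (\<lambda>i. At \<Lambda> p (x' i))"
  let ?y = "case_sum (\<lambda>i. At \<Lambda> q' (y i)) (\<lambda>i. At \<Lambda> q (y' i))"
  have ex: "At \<Lambda> (p + p') (f + g) = (\<Sum>i\<in>?I. ?x i)"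
    using 1 2 At_shift[of f p _ p'] At_shift[of g p' _ p]
    by (simp add: At_add At_sum sum.Plus add.commute)
  have ey: "At \<Lambda> (q + q') (f' + g') = (\<Sum>i\<in>?I. ?y i)"
    using 1 2 At_shift[of f' q _ q'] At_shift[of g' q' _ q]
    by (simp add: At_add At_sum sum.Plus add.commute)
  show ?thesis
  proof (rule approx_relI[where I = ?I and x = ?x and y = ?y])
    show "sim \<Lambda> (f + g) (\<Sum>i\<in>?I. ?x i)"
      using sim_At[of "f + g" "p + p'"] 1 2 by (simp only: ex[symmetric]) (simp add: sim_sym)
    show "sim \<Lambda> (f' + g') (\<Sum>i\<in>?I. ?y i)"
      using sim_At[of "f' + g'" "q + q'"] 1 2 by (simp only: ey[symmetric]) (simp add: sim_sym)
    fix i assume "i \<in> ?I"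
    then show "?x i \<in> NV \<Lambda> \<and> ?y i \<in> NV \<Lambda> \<and> sim \<Lambda> (?x i) (?y i)"
      using 1(3) 2(3) by (auto simp: At_NV sim_At_At)
  next
    show "f + g \<in> NV \<Lambda>" "f' + g' \<in> NV \<Lambda>" using 1(1,2) 2(1,2) by simp_all
    show "finite ?I" by simp
  qed
qed

lemma S_mult_class:
  assumes "f \<in> NV \<Lambda>" "g \<in> NV \<Lambda>"
  shows "(approx_rel \<Lambda> `` {f}) \<otimes>\<^bsub>S \<Lambda>\<^esub> (approx_rel \<Lambda> `` {g}) = approx_rel \<Lambda> `` {f + g}"
proof -
  have "congruent2 (approx_rel \<Lambda>) (approx_rel \<Lambda>) (\<lambda>f g. approx_rel \<Lambda> `` {f + g})"
    by (rule congruent2I'[OF equiv_class_eq[OF equiv_approx_rel approx_rel_add]])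
  then show ?thesis
    using UN_equiv_class2[OF equiv_approx_rel equiv_approx_rel _ assms] by (simp add: S_def)
qed

lemma comm_monoid_S: "comm_monoid (S \<Lambda>)"
proof -
  have carrier: "\<exists>f\<in>NV \<Lambda>. a = approx_rel \<Lambda> `` {f}" if "a \<in> carrier (S \<Lambda>)" for a
    using that by (auto simp: S_def quotient_def)
  have cl: "approx_rel \<Lambda> `` {f} \<in> carrier (S \<Lambda>)" if "f \<in> NV \<Lambda>" for f
    using that by (auto simp: S_def intro: quotientI)
  have one: "\<one>\<^bsub>S \<Lambda>\<^esub> = approx_rel \<Lambda> `` {{#}}" by (simp add: S_def)
  show ?thesis
    by (rule comm_monoidI)
       (auto simp: one S_mult_class cl add_ac dest!: carrier)
qed

end

end

theory Submission
  imports Defs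
begin

text \<open>
  Comparing the row and column proportionality through the commutation
  \<open>A\<^sub>i A\<^sub>j = A\<^sub>j A\<^sub>i\<close> shows that \<open>n w i j\<close> does not change along
  edges, so by cofinality it is one constant \<open>p/q\<close> in lowest terms. Then every entry of
  \<open>A\<^sub>j\<close> is divisible by \<open>q\<close>, so each \<open>f\<close> has some \<open>g\<close> with
  \<open>A\<^sub>i\<^sup>t f = p g\<close> and \<open>A\<^sub>j\<^sup>t f = q g\<close>. Hence \<open>[f] = p [g] = q [g]\<close> with
  \<open>p \<noteq> q\<close>, which absorbs arbitrarily many copies of \<open>\<bar>p - q\<bar> [g]\<close>.
\<close>

section \<open>Division of multisets, and ratios in lowest terms\<close>

lemma ex_repeat_mset:
  assumes "\<And>w. Q dvd count h w"
  shows "\<exists>g. h = repeat_mset Q g \<and> set_mset g \<subseteq> set_mset h"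
proof -
  define g where "g = Abs_multiset (\<lambda>w. count h w div Q)"
  have "{w. 0 < count h w div Q} \<subseteq> set_mset h"
    by (auto simp flip: count_greater_zero_iff dest: gr_implies_not0 intro!: Nat.gr0I)
  then have "finite {w. 0 < count h w div Q}"
    using finite_subset finite_set_mset by blast
  then have count_g: "count g w = count h w div Q" for w
    unfolding g_def by (simp add: count_Abs_multiset)
  show ?thesis
  proof (intro exI[of _ g] conjI)
    show "h = repeat_mset Q g"
      using assms by (intro multiset_eqI) (simp add: count_g)
    show "set_mset g \<subseteq> set_mset h"
      by (auto simp flip: count_greater_zero_iff simp: count_g dest: gr_implies_not0 intro!: Nat.gr0I)
  qed
qed

text \<open>Comparing multiplicities, coprimality forces \<open>Q\<close> to divide every entry of
  \<open>h'\<close>; cancelling \<open>Q > 0\<close> then determines \<open>h\<close>. The support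
  clause serves to place \<open>g\<close> in \<open>NV \<Lambda>\<close>.\<close>

lemma proportional_mset:
  assumes "coprime P Q" "Q > 0" "repeat_mset Q h = repeat_mset P h'"
  shows "\<exists>g. h = repeat_mset P g \<and> h' = repeat_mset Q g \<and> set_mset g \<subseteq> set_mset h'"
proof -
  have eq: "Q * count h w = P * count h' w" for w
    using arg_cong[OF assms(3), of "\<lambda>x. count x w"] by simp
  have "Q dvd count h' w" for w
    using eq[of w] assms(1) by (metis coprime_commute coprime_dvd_mult_right_iff dvd_triv_left)
  then obtain g where g: "h' = repeat_mset Q g" "set_mset g \<subseteq> set_mset h'"
    using ex_repeat_mset by metis
  have "count h w = P * count g w" for w
    using eq[of w] assms(2) by (simp add: g(1))
  then have "h = repeat_mset P g"
    by (intro multiset_eqI) simp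
  then show ?thesis using g by blast
qed

lemma pos_rat_obtain_coprime:
  fixes r :: rat
  assumes "r > 0"
  obtains P Q :: nat where "P > 0" "Q > 0" "coprime P Q" "r = of_nat P / of_nat Q"
proof -
  obtain a b where ab: "quotient_of r = (a, b)" by fastforce
  have b: "b > 0" and cop: "coprime a b" and r: "r = of_int a / of_int b"
    using ab quotient_of_denom_pos quotient_of_coprime quotient_of_div by blast+
  have a: "a > 0"
    using assms b unfolding r by (simp add: zero_less_divide_iff)
  have "coprime (nat a) (nat b)"
    using cop a b by (metis coprime_int_iff nat_0_le less_imp_le)
  moreover have "r = of_nat (nat a) / of_nat (nat b)"
    using r a b by simp
  ultimately show thesis
    using a b that[of "nat a" "nat b"] by simp
qed

lemma At_repeat: "At \<Lambda> n (repeat_mset k x) = repeat_mset k (At \<Lambda> n x)"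
  by (induction k) (simp_all add: At_add)

section \<open>Path counts as multiplicities in \<open>At\<close>\<close>

context row_finite_k_graph
begin

lemma count_At_single:
  assumes "v \<in> vertices \<Lambda>"
  shows "count (At \<Lambda> n {#v#}) w = card (paths_between \<Lambda> v n w)"
proof -
  have "count (At \<Lambda> n {#v#}) w = (\<Sum>\<mu>\<in>paths_at \<Lambda> v n. if src \<Lambda> \<mu> = w then 1 else 0)"
    by (auto simp: At_single count_sum intro: sum.cong)
  also have "\<dots> = card (paths_between \<Lambda> v n w)"
    using finite_paths_at[OF assms] by (simp add: paths_between_def sum.If_cases Int_def)
  finally show ?thesis .
qed

lemma src_in_At:
  assumes "x \<in> mor \<Lambda>"
  shows "src \<Lambda> x \<in># At \<Lambda> (deg \<Lambda> x) {#rng \<Lambda> x#}"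
proof -
  have v: "rng \<Lambda> x \<in> vertices \<Lambda>"
    by (simp add: vertices_eq_identities assms rng_mor src_rng)
  have "x \<in> paths_between \<Lambda> (rng \<Lambda> x) (deg \<Lambda> x) (src \<Lambda> x)"
    using assms by (simp add: paths_between_def paths_at_def mor_at_def paths_def)
  moreover have "finite (paths_between \<Lambda> (rng \<Lambda> x) (deg \<Lambda> x) (src \<Lambda> x))"
    using finite_paths_at[OF v] by (simp add: paths_between_def)
  ultimately show ?thesis
    unfolding count_greater_zero_iff[symmetric] count_At_single[OF v] by (auto simp: card_gt_0_iff)
qed

text \<open>Split one copy of \<open>v\<close> off \<open>At \<Lambda> p {#u#}\<close>: by
  additivity its image under the second map is a summand of the whole, so nothing in it is
  lost.\<close>

lemma in_At_trans:
  assumes "u \<in> vertices \<Lambda>" "v \<in># At \<Lambda> p {#u#}" "w \<in># At \<Lambda> q {#v#}"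
  shows "w \<in># At \<Lambda> (p + q) {#u#}"
proof -
  obtain y where "At \<Lambda> p {#u#} = {#v#} + y"
    using assms(2) by (metis insert_DiffM add_mset_add_single add.commute)
  then have "At \<Lambda> (p + q) {#u#} = At \<Lambda> q {#v#} + At \<Lambda> q y"
    using assms(1) by (simp add: At_add[of _ _ "{#v#}" y, simplified] flip: At_At)
  then show ?thesis using assms(3) by simp
qed

lemma sim_imp_approx:
  assumes "f \<in> NV \<Lambda>" "g \<in> NV \<Lambda>" "sim \<Lambda> f g"
  shows "(f, g) \<in> approx_rel \<Lambda>"
  by (rule approx_relI[where I = "{()}" and x = "\<lambda>_. f" and y = "\<lambda>_. g"])
     (use assms in \<open>simp_all add: sim_refl\<close>)

section \<open>Functions on vertices that are constant along edges\<close>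

text \<open>Induction on the total degree: a morphism of nonzero degree is an edge composed with a
  morphism of smaller total degree, and one of degree 0 is an identity.\<close>

lemma invariant_along_paths:
  assumes edge: "\<And>x i. x \<in> paths \<Lambda> (gen i) \<Longrightarrow> h (rng \<Lambda> x) = h (src \<Lambda> x)"
    and "x \<in> mor \<Lambda>"
  shows "h (rng \<Lambda> x) = h (src \<Lambda> x)"
  using assms(2)
proof (induction "\<Sum>i\<in>UNIV. deg \<Lambda> x $ i" arbitrary: x rule: less_induct)
  case less
  show ?case
  proof (cases "deg \<Lambda> x = 0")
    case True
    then have "x \<in> vertices \<Lambda>"
      using less.prems by (simp add: vertices_def paths_def)
    then have "src \<Lambda> x = x"
      by (simp add: vertices_eq_identities)
    then show ?thesis using rng_src[OF less.prems] by simp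
  next
    case False
    then obtain i where i: "deg \<Lambda> x $ i > 0"
      by (auto simp: vec_eq_iff)
    \<comment> \<open>Truncated subtraction is exact here: \<open>gen i\<close> vanishes off
      \<open>i\<close>, and the coordinate of the degree at \<open>i\<close> is positive.\<close>
    define d where "d = (\<chi> k. deg \<Lambda> x $ k - gen i $ k)"
    have "deg \<Lambda> x = gen i + d"
      using i by (auto simp: d_def vec_eq_iff gen_def axis_def)
    from unique_factorization[OF less.prems this] obtain \<mu> \<nu> where
      f: "\<mu> \<in> mor \<Lambda>" "\<nu> \<in> mor \<Lambda>" "src \<Lambda> \<mu> = rng \<Lambda> \<nu>" "deg \<Lambda> \<mu> = gen i" "deg \<Lambda> \<nu> = d"
        "x = cmp \<Lambda> \<mu> \<nu>"
      by auto
    have "(\<Sum>k\<in>UNIV. d $ k) < (\<Sum>k\<in>UNIV. deg \<Lambda> x $ k)"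
      by (rule sum_strict_mono_ex1) (use i in \<open>auto simp: d_def gen_def axis_def intro: exI[of _ i]\<close>)
    then have "h (rng \<Lambda> \<nu>) = h (src \<Lambda> \<nu>)"
      using less.hyps[of \<nu>] f by simp
    moreover have "h (rng \<Lambda> \<mu>) = h (src \<Lambda> \<mu>)"
      using edge[of \<mu> i] f by (simp add: paths_def)
    ultimately show ?thesis
      using f by (simp add: rng_cmp src_cmp)
  qed
qed

text \<open>Cofinality supplies a degree \<open>n\<close>, and the absence of sources a path of that
  degree with range \<open>w\<close>. Its source is also the source of a path with range
  \<open>v\<close>, so \<open>h\<close> takes one value at all three vertices.\<close>

lemma cofinal_invariant:
  assumes cof: "cofinal_graph \<Lambda>" and ns: "no_sources \<Lambda>"
    and edge: "\<And>x i. x \<in> paths \<Lambda> (gen i) \<Longrightarrow> h (rng \<Lambda> x) = h (src \<Lambda> x)"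
    and v: "v \<in> vertices \<Lambda>" and w: "w \<in> vertices \<Lambda>"
  shows "h v = h w"
proof -
  obtain n where n: "src \<Lambda> ` paths_at \<Lambda> w n \<subseteq> src \<Lambda> ` mor_at \<Lambda> v"
    using cof v w unfolding cofinal_graph_def by blast
  obtain x where x: "x \<in> paths_at \<Lambda> w n"
    using ns w unfolding no_sources_def by blast
  then obtain y where y: "y \<in> mor_at \<Lambda> v" "src \<Lambda> x = src \<Lambda> y"
    using n by blast
  have "x \<in> mor \<Lambda>" "y \<in> mor \<Lambda>"
    using x y by (simp_all add: paths_at_def mor_at_def)
  then have "h (rng \<Lambda> x) = h (src \<Lambda> x)" "h (rng \<Lambda> y) = h (src \<Lambda> y)"
    using edge invariant_along_paths[of h] by blast+
  then show ?thesis using x y by (simp add: paths_at_def mor_at_def)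
qed

section \<open>Proportional columns and rows\<close>

text \<open>The factor \<open>c\<close> belongs to the column \<open>w\<close> and is the same for
  every row \<open>u\<close>, so it survives summation over the vertices in
  \<open>x\<close>.\<close>

lemma count_At_column:
  fixes c :: "'b::semiring_1"
  assumes "x \<in> NV \<Lambda>"
    and "\<And>u. u \<in> vertices \<Lambda> \<Longrightarrow>
      of_nat (card (paths_between \<Lambda> u p w)) = c * of_nat (card (paths_between \<Lambda> u q w))"
  shows "of_nat (count (At \<Lambda> p x) w) = c * of_nat (count (At \<Lambda> q x) w)"
  using assms(1)
proof (induction x)
  case (add v x)
  then have "of_nat (count (At \<Lambda> p {#v#}) w) = c * of_nat (count (At \<Lambda> q {#v#}) w)"
    using assms(2) by (simp add: count_At_single)
  then have "of_nat (count (At \<Lambda> p ({#v#} + x)) w) = c * of_nat (count (At \<Lambda> q ({#v#} + x)) w)"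
    using add by (simp only: At_add count_union of_nat_add distrib_left NV_add_mset)
  then show ?case by simp
qed simp

lemma At_row:
  assumes "v \<in> vertices \<Lambda>" "Q > 0"
    and "\<And>w. w \<in> vertices \<Lambda> \<Longrightarrow> (of_nat (card (paths_between \<Lambda> v p w)) :: rat)
      = of_nat P / of_nat Q * of_nat (card (paths_between \<Lambda> v q w))"
  shows "repeat_mset Q (At \<Lambda> p {#v#}) = repeat_mset P (At \<Lambda> q {#v#})"
proof (rule multiset_eqI)
  fix w
  show "count (repeat_mset Q (At \<Lambda> p {#v#})) w = count (repeat_mset P (At \<Lambda> q {#v#})) w"
  proof (cases "w \<in> vertices \<Lambda>")
    case True
    have "(of_nat Q :: rat) * of_nat (card (paths_between \<Lambda> v p w))
        = of_nat P * of_nat (card (paths_between \<Lambda> v q w))"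
      using assms(2) assms(3)[OF True] by simp
    then have "Q * card (paths_between \<Lambda> v p w) = P * card (paths_between \<Lambda> v q w)"
      by (simp only: of_nat_mult[symmetric] of_nat_eq_iff)
    then show ?thesis
      using assms(1) by (simp add: count_At_single)
  next
    \<comment> \<open>The proportionality hypothesis speaks only of vertices; elsewhere both
      multiplicities are 0.\<close>
    case False
    then have "count (At \<Lambda> r {#v#}) w = 0" for r
      using At_NV[of "{#v#}" r] assms(1) by (auto simp: NV_def count_eq_zero_iff)
    then show ?thesis by simp
  qed
qed

section \<open>Absorption from two different multiples of one class\<close>

text \<open>In the semigroup \<open>[f] = P[g] = Q[g]\<close>, so \<open>Q[g]\<close> absorbs
  \<open>P - Q\<close> further copies of \<open>[g]\<close> any number of times, enough to cover
  \<open>2Q[g]\<close>.\<close>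

lemma purely_infinite_class:
  assumes f: "f \<in> NV \<Lambda>" and g: "g \<in> NV \<Lambda>" and Q: "Q > 0" and PQ: "P > Q"
    and p: "At \<Lambda> p f = repeat_mset P g" and q: "At \<Lambda> q f = repeat_mset Q g"
  shows "\<exists>c\<in>NV \<Lambda>. (f + f + c, f) \<in> approx_rel \<Lambda>"
proof -
  have rep: "repeat_mset k g \<in> NV \<Lambda>" for k
    using g by (induction k) simp_all
  have fP: "(f, repeat_mset P g) \<in> approx_rel \<Lambda>" and fQ: "(f, repeat_mset Q g) \<in> approx_rel \<Lambda>"
    using f rep sim_At[OF f, of p] sim_At[OF f, of q] unfolding p q
    by (auto intro: sim_imp_approx sim_sym)
  have symD: "(a, b) \<in> approx_rel \<Lambda> \<Longrightarrow> (b, a) \<in> approx_rel \<Lambda>" for a b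
    using equiv_approx_rel by (meson equivE symE)
  have refl: "a \<in> NV \<Lambda> \<Longrightarrow> (a, a) \<in> approx_rel \<Lambda>" for a
    by (simp add: sim_imp_approx sim_refl)
  \<comment> \<open>Each round trades \<open>P\<close> copies of \<open>g\<close> for
    \<open>Q\<close> copies, lowering \<open>k\<close> by one.\<close>
  have absorb: "(repeat_mset (Q + k * (P - Q)) g, f) \<in> approx_rel \<Lambda>" for k
  proof (induction k)
    case 0
    then show ?case using symD[OF fQ] by simp
  next
    case (Suc k)
    have "Q + Suc k * (P - Q) = P + k * (P - Q)"
      using PQ by simp
    then have eq: "repeat_mset (Q + Suc k * (P - Q)) g
        = repeat_mset P g + repeat_mset (k * (P - Q)) g"
      by (simp only: repeat_mset_distrib)
    have "(repeat_mset P g, repeat_mset Q g) \<in> approx_rel \<Lambda>"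
      by (rule approx_rel_trans[OF symD[OF fP] fQ])
    then have "(repeat_mset P g + repeat_mset (k * (P - Q)) g,
        repeat_mset Q g + repeat_mset (k * (P - Q)) g) \<in> approx_rel \<Lambda>"
      by (rule approx_rel_add) (rule refl[OF rep])
    then show ?case
      using approx_rel_trans[OF _ Suc.IH] unfolding eq by (simp only: repeat_mset_distrib)
  qed
  \<comment> \<open>Chosen so that \<open>2Q + Q(P - Q - 1) = Q + Q(P - Q)\<close>, which is the
    absorbed form with \<open>k = Q\<close>; the subtraction is exact because
    \<open>P > Q\<close>.\<close>
  define c where "c = repeat_mset (Q * (P - Q - 1)) g"
  have "Q + Q + Q * (P - Q - 1) = Q + Q * (P - Q)"
    using PQ by (cases "P - Q") auto
  then have "repeat_mset Q g + repeat_mset Q g + c = repeat_mset (Q + Q * (P - Q)) g"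
    unfolding c_def by (simp only: repeat_mset_distrib[symmetric])
  moreover have "(f + f + c, repeat_mset Q g + repeat_mset Q g + c) \<in> approx_rel \<Lambda>"
    by (intro approx_rel_add fQ refl) (simp add: c_def rep)
  ultimately have "(f + f + c, f) \<in> approx_rel \<Lambda>"
    using approx_rel_trans[OF _ absorb[of Q]] by (simp only:)
  moreover have "c \<in> NV \<Lambda>" by (simp add: c_def rep)
  ultimately show ?thesis by blast
qed

lemma purely_infinite_S_I:
  assumes "\<And>f. f \<in> NV \<Lambda> \<Longrightarrow> \<exists>c\<in>NV \<Lambda>. (f + f + c, f) \<in> approx_rel \<Lambda>"
  shows "purely_infinite (S \<Lambda>)"
  unfolding purely_infinite_def
proof
  fix a assume "a \<in> carrier (S \<Lambda>)"
  then obtain f where f: "f \<in> NV \<Lambda>" and a: "a = approx_rel \<Lambda> `` {f}"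
    by (auto simp: S_def quotient_def)
  obtain c where c: "c \<in> NV \<Lambda>" and e: "(f + f + c, f) \<in> approx_rel \<Lambda>"
    using assms[OF f] by blast
  have "a \<otimes>\<^bsub>S \<Lambda>\<^esub> a \<otimes>\<^bsub>S \<Lambda>\<^esub> (approx_rel \<Lambda> `` {c}) = a"
    using equiv_class_eq[OF equiv_approx_rel e] f c by (simp add: a S_mult_class)
  moreover have "approx_rel \<Lambda> `` {c} \<in> carrier (S \<Lambda>)"
    using c by (simp add: S_def quotientI)
  ultimately show "alg_le (S \<Lambda>) (a \<otimes>\<^bsub>S \<Lambda>\<^esub> a) a"
    unfolding alg_le_def by blast
qed

section \<open>Constancy of the row ratio\<close>

text \<open>Both row ratios equal the column ratio \<open>m w\<close> of a vertex \<open>w\<close>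
  reached from \<open>v\<close> by a path of degree \<open>q\<close>: for \<open>v\<close> by
  comparing paths from \<open>v\<close> to \<open>w\<close>, for \<open>u\<close> by comparing
  two-stage paths from \<open>u\<close> to \<open>w\<close>.\<close>

lemma ratio_edge_invariant:
  fixes n m :: "'a \<Rightarrow> rat"
  assumes ns: "no_sources \<Lambda>"
    and pos: "\<And>w. w \<in> vertices \<Lambda> \<Longrightarrow> n w > 0"
    and row: "\<And>w v. w \<in> vertices \<Lambda> \<Longrightarrow> v \<in> vertices \<Lambda> \<Longrightarrow>
      of_nat (card (paths_between \<Lambda> w p v)) = n w * of_nat (card (paths_between \<Lambda> w q v))"
    and col: "\<And>w u. w \<in> vertices \<Lambda> \<Longrightarrow> u \<in> vertices \<Lambda> \<Longrightarrow>
      of_nat (card (paths_between \<Lambda> u p w)) = m w * of_nat (card (paths_between \<Lambda> u q w))"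
    and u: "u \<in> vertices \<Lambda>" and v: "v \<in># At \<Lambda> q {#u#}"
  shows "n u = n v"
proof -
  have vV: "v \<in> vertices \<Lambda>"
    using At_NV[of "{#u#}" q] u v by (auto simp: NV_def)
  obtain x where x: "x \<in> paths_at \<Lambda> v q"
    using ns vV unfolding no_sources_def by blast
  define w where "w = src \<Lambda> x"
  have w: "w \<in># At \<Lambda> q {#v#}"
    using src_in_At[of x] x by (simp add: w_def paths_at_def mor_at_def paths_def)
  have wV: "w \<in> vertices \<Lambda>"
    using x by (simp add: w_def src_vertices paths_at_def mor_at_def)
  \<comment> \<open>Both sides count the paths of degree \<open>p\<close> between \<open>v\<close>
    and \<open>w\<close>, by the row of \<open>v\<close> and by the column of \<open>w\<close>. The
    common factor is nonzero by the choice of \<open>w\<close>.\<close>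
  have "n v * of_nat (count (At \<Lambda> q {#v#}) w) = m w * of_nat (count (At \<Lambda> q {#v#}) w)"
    unfolding count_At_single[OF vV] using row[OF vV wV] col[OF wV vV] by (rule trans[OF sym])
  then have nv: "n v = m w" using w by (auto simp flip: not_in_iff)
  obtain P Q :: nat where PQ: "P > 0" "Q > 0" "coprime P Q" "n u = of_nat P / of_nat Q"
    using pos_rat_obtain_coprime[OF pos[OF u]] by blast
  define X where "X = At \<Lambda> q (At \<Lambda> q {#u#})"
  have X: "count X w > 0"
    using in_At_trans[OF u v w] u by (simp add: X_def At_At)
  \<comment> \<open>Commuting the two maps puts degree \<open>p\<close> first, where the row
    relation at \<open>u\<close> applies.\<close>
  have "repeat_mset Q (At \<Lambda> p (At \<Lambda> q {#u#})) = At \<Lambda> q (repeat_mset Q (At \<Lambda> p {#u#}))"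
    using u by (simp add: At_repeat At_At add.commute)
  also have "\<dots> = repeat_mset P X"
    using At_row[OF u PQ(2), of p P q] row[OF u] PQ(4) by (simp add: At_repeat X_def)
  finally have "Q * count (At \<Lambda> p (At \<Lambda> q {#u#})) w = P * count X w"
    by (metis count_repeat_mset)
  then have "of_nat Q * (of_nat (count (At \<Lambda> p (At \<Lambda> q {#u#})) w) :: rat) = of_nat P * of_nat (count X w)"
    by (simp only: of_nat_mult[symmetric])
  \<comment> \<open>The same entry, now with degree \<open>p\<close> second, where the column
    relation at \<open>w\<close> applies to every vertex in
    \<open>At \<Lambda> q {#u#}\<close>.\<close>
  moreover have "of_nat (count (At \<Lambda> p (At \<Lambda> q {#u#})) w) = m w * of_nat (count X w)"
    unfolding X_def using u by (intro count_At_column col wV At_NV) simp_all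
  ultimately have "of_nat Q * m w = of_nat P"
    using X by simp
  then have "n u = m w"
    using PQ(2) by (simp add: PQ(4) field_simps)
  then show ?thesis using nv by simp
qed

end

theorem proposition6p6:
  fixes \<Lambda> :: "('a, 'k::finite) graph_data"
    and l :: "'a \<Rightarrow> int"
    and n m :: "'a \<Rightarrow> 'k \<Rightarrow> 'k \<Rightarrow> rat"
  assumes "k_graph \<Lambda>" and "row_finite \<Lambda>" and "cofinal_graph \<Lambda>" and "no_sources \<Lambda>"
    and "\<And>i x. x \<in> paths \<Lambda> (gen i) \<Longrightarrow> l (src \<Lambda> x) = 1 + l (rng \<Lambda> x)"
    and "\<And>w i j. w \<in> vertices \<Lambda> \<Longrightarrow> i \<noteq> j \<Longrightarrow> n w i j > 0 \<and> m w i j > 0"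
    and "\<And>w i j v. w \<in> vertices \<Lambda> \<Longrightarrow> i \<noteq> j \<Longrightarrow> v \<in> vertices \<Lambda> \<Longrightarrow>
           of_nat (card (paths_between \<Lambda> w (gen i) v))
             = n w i j * of_nat (card (paths_between \<Lambda> w (gen j) v))"
    and "\<And>w i j u. w \<in> vertices \<Lambda> \<Longrightarrow> i \<noteq> j \<Longrightarrow> u \<in> vertices \<Lambda> \<Longrightarrow>
           of_nat (card (paths_between \<Lambda> u (gen i) w))
             = m w i j * of_nat (card (paths_between \<Lambda> u (gen j) w))"
    and "\<exists>w\<in>vertices \<Lambda>. \<exists>i j. i \<noteq> j \<and> n w i j \<noteq> 1"
  shows "purely_infinite (S \<Lambda>)"
proof -
  interpret row_finite_k_graph \<Lambda>
    using assms(1,2) by (simp add: row_finite_k_graph_def row_finite_k_graph_axioms_def)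
  obtain w0 i j where w0: "w0 \<in> vertices \<Lambda>" and ij: "i \<noteq> j" and n0: "n w0 i j \<noteq> 1"
    using assms(9) by blast
  note row = assms(7)[OF _ ij] and col = assms(8)[OF _ ij]
  have edge: "n (rng \<Lambda> x) i j = n (src \<Lambda> x) i j" if x: "x \<in> paths \<Lambda> (gen k)" for x k
  proof (rule ratio_edge_invariant[where p = "gen i" and q = "gen j" and n = "\<lambda>w. n w i j"
        and m = "\<lambda>w. m w i j"])
    have xm: "x \<in> mor \<Lambda>" and dx: "deg \<Lambda> x = gen k"
      using x by (simp_all add: paths_def)
    show r: "rng \<Lambda> x \<in> vertices \<Lambda>"
      by (simp add: vertices_eq_identities xm rng_mor src_rng)
    have k: "src \<Lambda> x \<in># At \<Lambda> (gen k) {#rng \<Lambda> x#}"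
      using src_in_At[OF xm] dx by simp
    show "src \<Lambda> x \<in># At \<Lambda> (gen j) {#rng \<Lambda> x#}"
    proof (cases "k = j")
      \<comment> \<open>An edge of degree \<open>gen k\<close> forces one of degree
        \<open>gen j\<close> between the same vertices, since the counts are proportional and the
        first is nonzero.\<close>
      case False
      have "card (paths_between \<Lambda> (rng \<Lambda> x) (gen k) (src \<Lambda> x)) \<noteq> 0"
        using k unfolding count_At_single[OF r, symmetric] by simp
      then have "card (paths_between \<Lambda> (rng \<Lambda> x) (gen j) (src \<Lambda> x)) \<noteq> 0"
        using assms(7)[OF r False src_vertices[OF xm]] by (metis mult_zero_right of_nat_eq_0_iff)
      then show ?thesis
        unfolding count_At_single[OF r, symmetric] by simp
    qed (use k in simp)
  qed (use assms(4) assms(6)[OF _ ij] row col in auto)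
  have const: "n w i j = n w0 i j" if "w \<in> vertices \<Lambda>" for w
    by (rule cofinal_invariant[where h = "\<lambda>w. n w i j", OF assms(3,4) _ that w0]) (rule edge)
  obtain P Q :: nat where PQ: "P > 0" "Q > 0" "coprime P Q" "n w0 i j = of_nat P / of_nat Q"
    using pos_rat_obtain_coprime assms(6)[OF w0 ij] by blast
  have ne: "P \<noteq> Q" using n0 PQ by auto
  \<comment> \<open>With one ratio \<open>P/Q\<close> for all vertices, the relations for single
    rows add up over \<open>f\<close>.\<close>
  have ratio: "repeat_mset Q (At \<Lambda> (gen i) f) = repeat_mset P (At \<Lambda> (gen j) f)" if "f \<in> NV \<Lambda>" for f
    using that
  proof (induction f)
    case (add v f)
    then have v: "v \<in> vertices \<Lambda>" and f: "f \<in> NV \<Lambda>" by simp_all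
    have "repeat_mset Q (At \<Lambda> (gen i) {#v#}) = repeat_mset P (At \<Lambda> (gen j) {#v#})"
      using row[OF v] const[OF v] PQ(4) by (intro At_row v PQ(2)) simp
    then have "repeat_mset Q (At \<Lambda> (gen i) ({#v#} + f)) = repeat_mset P (At \<Lambda> (gen j) ({#v#} + f))"
      using add.IH[OF f] by (simp only: At_add repeat_mset_distrib2)
    then show ?case by simp
  qed simp
  show ?thesis
  proof (rule purely_infinite_S_I)
    fix f assume f: "f \<in> NV \<Lambda>"
    obtain g where g: "At \<Lambda> (gen i) f = repeat_mset P g" "At \<Lambda> (gen j) f = repeat_mset Q g"
      "set_mset g \<subseteq> set_mset (At \<Lambda> (gen j) f)"
      using proportional_mset[OF PQ(3,2) ratio[OF f]] by blast
    have gN: "g \<in> NV \<Lambda>"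
      using g(3) At_NV[OF f, of "gen j"] by (auto simp: NV_def)
    show "\<exists>c\<in>NV \<Lambda>. (f + f + c, f) \<in> approx_rel \<Lambda>"
    proof (cases "P > Q")
      case True
      then show ?thesis using purely_infinite_class[OF f gN PQ(2) _ g(1,2)] by blast
    next
      \<comment> \<open>Exchanging \<open>i\<close> with \<open>j\<close> exchanges \<open>P\<close>
        with \<open>Q\<close>, so the same absorption argument applies.\<close>
      case False
      then have "Q > P" using ne by simp
      then show ?thesis using purely_infinite_class[OF f gN PQ(1) _ g(2,1)] by blast
    qed
  qed
qed

end
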